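(* Fix $z\in(0,1/4)$. The function $x\mapsto zQ(x,0,z)$, holomorphic in the unit disc, can be continued as a holomorphic function to $\mathbb{C}\setminus[x_3,x_4]$, and the function $y\mapsto z(y+1)Q(0,y,z)$, holomorphic in the unit disc, can be continued as a holomorphic function to $\mathbb{C}\setminus[y_3,y_4]$. Moreover, with these continuations, for every $y\in\mathbb{C}\setminus([y_1,y_2]\cup[y_3,y_4])$, $$zQ(X_0(y),0,z)+z(y+1)Q(0,y,z)-zQ(0,0,z)-X_0(y)y=0,$$ and for every $x\in\mathbb{C}\setminus([x_1,x_2]\cup[x_3,x_4])$, $$zQ(x,0,z)+z(Y_0(x)+1)Q(0,Y_0(x),z)-zQ(0,0,z)-xY_0(x)=0.$$
   Context: Gessel's walks are lattice walks in $\mathbb{Z}_+^2$ starting at $(0,0)$, with unit steps $(-1,0)$, $(1,1)$, $(1,0)$, $(-1,-1)$, never leaving $\mathbb{Z}_+^2$. Let $q(i,j,k)$ be the number of such walks of length $k$ ending at $(i,j)$, and $Q(x,y,z)=\sum_{i,j,k\ge0}q(i,j,k)x^iy^jz^k$ (convergent for $|x|\le1,|y|\le1,|z|<1/4$). Fix $z\in(0,1/4)$ and set $\tilde a(y)=zy(y+1)$, $\tilde b(y)=-y$, $\tilde c(y)=z(y+1)$, $a(x)=zx^2$, $b(x)=zx^2-x+z$, $c(x)=z$, so that $xyz(1/x+1/(xy)+x+xy-1/z)=\tilde a(y)x^2+\tilde b(y)x+\tilde c(y)=a(x)y^2+b(x)y+c(x)$; put $\tilde d=\tilde b^2-4\tilde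 a\tilde c$ and $d=b^2-4ac$. The roots of $\tilde d$ are $y_1=0$, $y_2=[1-8z^2-(1-16z^2)^{1/2}]/(8z^2)$, $y_3=[1-8z^2+(1-16z^2)^{1/2}]/(8z^2)$, and one sets $y_4=\infty$; the roots of $d$ are $x_1=[1+2z-(1+4z)^{1/2}]/(2z)$, $x_2=[1-2z-(1-4z)^{1/2}]/(2z)$, $x_3=[1-2z+(1-4z)^{1/2}]/(2z)$, $x_4=[1+2z+(1+4z)^{1/2}]/(2z)$, with $0<x_1<x_2<1<x_3<x_4$ and $0<y_2<1<y_3$. The two branches $X_0,X_1$ of the algebraic function $X(y)$ defined by $\tilde a(y)X^2+\tilde b(y)X+\tilde c(y)=0$, namely $(-\tilde b(y)\pm\tilde d(y)^{1/2})/(2\tilde a(y))$, are meromorphic on $\mathbb{C}\setminus([y_1,y_2]\cup[y_3,y_4])$ and labeled so that $|X_0(y)|\le|X_1(y)|$; similarly $Y_0,Y_1$, the branches $(-b(x)\pm d(x)^{1/2})/(2a(x))$ of the roots of $a(x)Y^2+b(x)Y+c(x)=0$, are meromorphic on $\mathbb{C}\setminus([x_1,x_2]\cup[x_3,x_4])$ with $|Y_0(x)|\le|Y_1(x)|$. *)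

theory Defs
  imports "HOL-Complex_Analysis.Complex_Analysis"
begin

definition gessel_steps :: "(int \<times> int) set" where
  "gessel_steps = {(-1,0), (1,1), (1,0), (-1,-1)}"

definition walk_pos :: "(int \<times> int) list \<Rightarrow> nat \<Rightarrow> int \<times> int" where
  "walk_pos w n = ((\<Sum>s\<leftarrow>take n w. fst s), (\<Sum>s\<leftarrow>take n w. snd s))"

definition gessel_q :: "nat \<Rightarrow> nat \<Rightarrow> nat \<Rightarrow> nat" where
  "gessel_q i j k = card {w. length w = k \<and> set w \<subseteq> gessel_steps
      \<and> (\<forall>n\<le>k. fst (walk_pos w n) \<ge> 0 \<and> snd (walk_pos w n) \<ge> 0)
      \<and> walk_pos w k = (int i, int j)}"

text \<open>Q(x,y,z) = sum over i,j,k of q(i,j,k) x^i y^j z^k, grouped by length k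
  (q(i,j,k) = 0 unless i,j \<le> k).\<close>
definition gessel_Q :: "complex \<Rightarrow> complex \<Rightarrow> complex \<Rightarrow> complex" where
  "gessel_Q x y z = (\<Sum>k. \<Sum>i\<le>k. \<Sum>j\<le>k. of_nat (gessel_q i j k) * x ^ i * y ^ j * z ^ k)"

definition kat :: "real \<Rightarrow> complex \<Rightarrow> complex" where "kat z y = z * y * (y + 1)"
definition kbt :: "real \<Rightarrow> complex \<Rightarrow> complex" where "kbt z y = - y"
definition kct :: "real \<Rightarrow> complex \<Rightarrow> complex" where "kct z y = z * (y + 1)"
definition ka :: "real \<Rightarrow> complex \<Rightarrow> complex" where "ka z x = z * x\<^sup>2"
definition kb :: "real \<Rightarrow> complex \<Rightarrow> complex" where "kb z x = z * x\<^sup>2 - x + z"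
definition kc :: "real \<Rightarrow> complex \<Rightarrow> complex" where "kc z x = z"

definition x1 :: "real \<Rightarrow> real" where "x1 z = (1 + 2*z - sqrt (1 + 4*z)) / (2*z)"
definition x2 :: "real \<Rightarrow> real" where "x2 z = (1 - 2*z - sqrt (1 - 4*z)) / (2*z)"
definition x3 :: "real \<Rightarrow> real" where "x3 z = (1 - 2*z + sqrt (1 - 4*z)) / (2*z)"
definition x4 :: "real \<Rightarrow> real" where "x4 z = (1 + 2*z + sqrt (1 + 4*z)) / (2*z)"
definition y1 :: "real \<Rightarrow> real" where "y1 z = 0"
definition y2 :: "real \<Rightarrow> real" where "y2 z = (1 - 8*z^2 - sqrt (1 - 16*z^2)) / (8*z^2)"
definition y3 :: "real \<Rightarrow> real" where "y3 z = (1 - 8*z^2 + sqrt (1 - 16*z^2)) / (8*z^2)"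

text \<open>The cuts [x1,x2], [x3,x4], [y1,y2] and [y3,y4] with y4 = infinity.\<close>
definition xcut12 :: "real \<Rightarrow> complex set" where
  "xcut12 z = closed_segment (of_real (x1 z)) (of_real (x2 z))"
definition xcut34 :: "real \<Rightarrow> complex set" where
  "xcut34 z = closed_segment (of_real (x3 z)) (of_real (x4 z))"
definition ycut12 :: "real \<Rightarrow> complex set" where
  "ycut12 z = closed_segment (of_real (y1 z)) (of_real (y2 z))"
definition ycut34 :: "real \<Rightarrow> complex set" where
  "ycut34 z = {of_real t | t. t \<ge> y3 z}"

text \<open>Branch of smaller modulus of the roots of A X^2 + B X + C = 0; when A = 0 the other
  branch has a pole, so the finite root -C/B is the one of smaller modulus.\<close>
definition small_root :: "complex \<Rightarrow> complex \<Rightarrow> complex \<Rightarrow> complex" where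
  "small_root A B C =
     (if A = 0 then - C / B
      else (let r1 = (- B + csqrt (B\<^sup>2 - 4*A*C)) / (2*A);
                r2 = (- B - csqrt (B\<^sup>2 - 4*A*C)) / (2*A)
            in if norm r1 \<le> norm r2 then r1 else r2))"

definition X0 :: "real \<Rightarrow> complex \<Rightarrow> complex" where
  "X0 z y = small_root (kat z y) (kbt z y) (kct z y)"
definition Y0 :: "real \<Rightarrow> complex \<Rightarrow> complex" where
  "Y0 z x = small_root (ka z x) (kb z x) (kc z x)"

end

(*
  On the kernel curve the two roots in Y have product 1/x^2 and the two roots in X have product 1/y,
  so off the cuts Y0 is characterised by |x Y0| < 1 and X0 by |X0^2 y| < 1. If |x| >= 1, the first
  inequality gives |Y0(x)| < 1, and the functional equation, which holds a priori only on the
  bidisc, determines the continuation of z Q(x,0,z) through the series z (y+1) Q(0,y,z). If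
  |y| >= 1, the second inequality gives |X0(y)| < 1, and the roles are exchanged. At a point of the
  curve with |x| >= 1 or |y| >= 1 the two characterisations of the small root make Y0 and X0
  inverse to each other, so a single relation serves both identities.
*)
theory Submission
  imports Defs
begin

section \<open>The functional equation\<close>

definition gessel_walks :: "nat \<Rightarrow> (int \<times> int) list set" where
  "gessel_walks k = {w. length w = k \<and> set w \<subseteq> gessel_steps
      \<and> (\<forall>n\<le>k. fst (walk_pos w n) \<ge> 0 \<and> snd (walk_pos w n) \<ge> 0)}"

text \<open>Walks in the quadrant end at nonnegative coordinates, so \<open>nat\<close> loses
  nothing on them. At x = 0 the convention 0^0 = 1 makes the weight select the walks ending on the
  vertical axis, and likewise at y = 0 for the horizontal one.\<close>

definition walk_weight :: "complex \<Rightarrow> complex \<Rightarrow> (int \<times> int) list \<Rightarrow> complex" where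
  "walk_weight x y w = x ^ nat (fst (walk_pos w (length w))) * y ^ nat (snd (walk_pos w (length w)))"

text \<open>This is the coefficient of z^k in Q(x,y,z). Summing over walks rather than over end
  points makes appending a step a reindexing.\<close>

definition gessel_poly :: "nat \<Rightarrow> complex \<Rightarrow> complex \<Rightarrow> complex" where
  "gessel_poly k x y = (\<Sum>w\<in>gessel_walks k. walk_weight x y w)"

lemma finite_gessel_steps: "finite gessel_steps"
  and card_gessel_steps: "card gessel_steps = 4"
  by (auto simp: gessel_steps_def)

lemma finite_gessel_walks: "finite (gessel_walks k)"
  and card_gessel_walks: "card (gessel_walks k) \<le> 4 ^ k"
proof -
  have *: "gessel_walks k \<subseteq> {w. set w \<subseteq> gessel_steps \<and> length w = k}"
    by (auto simp: gessel_walks_def)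
  show "finite (gessel_walks k)"
    by (rule finite_subset[OF * finite_lists_length_eq[OF finite_gessel_steps]])
  show "card (gessel_walks k) \<le> 4 ^ k"
    using card_mono[OF finite_lists_length_eq[OF finite_gessel_steps] *]
    by (simp add: card_lists_length_eq finite_gessel_steps card_gessel_steps)
qed

lemma walk_pos_append:
  "n \<le> length w \<Longrightarrow> walk_pos (w @ [s]) n = walk_pos w n"
  "walk_pos (w @ [s]) (Suc (length w)) =
     (fst (walk_pos w (length w)) + fst s, snd (walk_pos w (length w)) + snd s)"
  by (auto simp: walk_pos_def)

lemma walk_pos_le:
  assumes "set w \<subseteq> gessel_steps"
  shows "fst (walk_pos w (length w)) \<le> int (length w)"
    and "snd (walk_pos w (length w)) \<le> int (length w)"
  using assms by (induction w) (auto simp: walk_pos_def gessel_steps_def)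

lemma gessel_walks_Suc:
  "gessel_walks (Suc k) = (\<lambda>(w, s). w @ [s]) ` (SIGMA w:gessel_walks k.
     {s \<in> gessel_steps. fst (walk_pos w (length w)) + fst s \<ge> 0 \<and>
                         snd (walk_pos w (length w)) + snd s \<ge> 0})" (is "?L = ?R")
proof
  show "?L \<subseteq> ?R"
  proof
    fix v assume v: "v \<in> ?L"
    then obtain w s where ws: "v = w @ [s]" "length w = k"
      by (auto simp: gessel_walks_def length_Suc_conv_rev)
    have nn: "fst (walk_pos v n) \<ge> 0 \<and> snd (walk_pos v n) \<ge> 0" if "n \<le> Suc k" for n
      using v that by (auto simp: gessel_walks_def)
    have "w \<in> gessel_walks k"
      unfolding gessel_walks_def
    proof (clarsimp simp: ws(2), intro conjI allI impI)
      show "set w \<subseteq> gessel_steps" using v ws by (auto simp: gessel_walks_def)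
      show "fst (walk_pos w n) \<ge> 0" "snd (walk_pos w n) \<ge> 0" if "n \<le> k" for n
        using nn[of n] that ws by (auto simp: walk_pos_append)
    qed
    moreover have "s \<in> gessel_steps" using v ws by (auto simp: gessel_walks_def)
    moreover have "fst (walk_pos w (length w)) + fst s \<ge> 0" "snd (walk_pos w (length w)) + snd s \<ge> 0"
      using nn[of "Suc k"] ws walk_pos_append(2)[of w s] by auto
    ultimately show "v \<in> ?R" using ws by auto
  qed
  show "?R \<subseteq> ?L"
  proof clarify
    fix w a b
    assume w: "w \<in> gessel_walks k" and s: "(a, b) \<in> gessel_steps"
      and p: "0 \<le> fst (walk_pos w (length w)) + fst (a, b)"
        "0 \<le> snd (walk_pos w (length w)) + snd (a, b)"
    have l: "length w = k" using w by (simp add: gessel_walks_def)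
    have "0 \<le> fst (walk_pos (w @ [(a, b)]) n) \<and> 0 \<le> snd (walk_pos (w @ [(a, b)]) n)"
      if "n \<le> Suc k" for n
    proof (cases "n = Suc k")
      case True
      then show ?thesis using p walk_pos_append(2)[of w "(a, b)"] l by simp
    next
      case False
      then show ?thesis using w that l by (simp add: walk_pos_append gessel_walks_def)
    qed
    then show "w @ [(a, b)] \<in> gessel_walks (Suc k)"
      using w s by (auto simp: gessel_walks_def)
  qed
qed

text \<open>The factor \<open>x * y\<close> clears the negative exponents, so the four steps
  contribute y, x^2 y^2, x^2 y and 1. At i = 0 the two leftward steps, worth y + 1, are forbidden;
  at j = 0 the step (-1,-1), worth 1, is. At the origin that step has been removed twice and is
  added back. The powers of 0 serve as indicators of i = 0 and j = 0.\<close>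

lemma sum_admissible_steps:
  fixes x y :: complex
  shows "(\<Sum>s | s \<in> gessel_steps \<and> int i + fst s \<ge> 0 \<and> int j + snd s \<ge> 0.
            x * y * (x ^ nat (int i + fst s) * y ^ nat (int j + snd s)))
       = (y + 1 + x\<^sup>2 * y + x\<^sup>2 * y\<^sup>2) * (x ^ i * y ^ j) - (y + 1) * (0 ^ i * y ^ j)
           - x ^ i * 0 ^ j + 0 ^ i * 0 ^ j"
proof -
  have e: "nat (int i + 1) = Suc i" "nat (int j + 1) = Suc j" "nat (2 + int j) = Suc (Suc j)"
    "nat (2 + int i) = Suc (Suc i)" by auto
  show ?thesis
    unfolding sum.inter_filter[OF finite_gessel_steps]
    by (cases i; cases j)
       (simp_all add: gessel_steps_def e nat_add_distrib algebra_simps power2_eq_square)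
qed

lemma gessel_poly_Suc:
  "x * y * gessel_poly (Suc k) x y =
     (y + 1 + x\<^sup>2 * y + x\<^sup>2 * y\<^sup>2) * gessel_poly k x y - (y + 1) * gessel_poly k 0 y
       - gessel_poly k x 0 + gessel_poly k 0 0"
proof -
  define S where "S w = {s \<in> gessel_steps. fst (walk_pos w (length w)) + fst s \<ge> 0 \<and>
                         snd (walk_pos w (length w)) + snd s \<ge> 0}" for w
  have fS: "finite (S w)" for w using finite_gessel_steps by (auto simp: S_def)
  have "gessel_poly (Suc k) x y =
      (\<Sum>(w, s)\<in>Sigma (gessel_walks k) S. walk_weight x y (w @ [s]))"
    unfolding gessel_poly_def gessel_walks_Suc S_def[symmetric]
    by (subst sum.reindex) (auto simp: inj_on_def case_prod_unfold)
  also have "\<dots> = (\<Sum>w\<in>gessel_walks k. \<Sum>s\<in>S w. walk_weight x y (w @ [s]))"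
    by (subst sum.Sigma) (auto simp: finite_gessel_walks fS)
  finally have "x * y * gessel_poly (Suc k) x y =
      (\<Sum>w\<in>gessel_walks k. \<Sum>s\<in>S w. x * y * walk_weight x y (w @ [s]))"
    by (simp add: sum_distrib_left)
  also have "\<dots> = (\<Sum>w\<in>gessel_walks k. (y + 1 + x\<^sup>2 * y + x\<^sup>2 * y\<^sup>2) * walk_weight x y w
      - (y + 1) * walk_weight 0 y w - walk_weight x 0 w + walk_weight 0 0 w)"
  proof (rule sum.cong[OF refl])
    fix w assume w: "w \<in> gessel_walks k"
    define i j where "i = nat (fst (walk_pos w (length w)))" "j = nat (snd (walk_pos w (length w)))"
    have ij: "fst (walk_pos w (length w)) = int i" "snd (walk_pos w (length w)) = int j"
      using w by (auto simp: gessel_walks_def i_j_def)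
    show "(\<Sum>s\<in>S w. x * y * walk_weight x y (w @ [s])) =
       (y + 1 + x\<^sup>2 * y + x\<^sup>2 * y\<^sup>2) * walk_weight x y w
      - (y + 1) * walk_weight 0 y w - walk_weight x 0 w + walk_weight 0 0 w"
      using sum_admissible_steps[where i = i and j = j and x = x and y = y]
      by (simp add: S_def walk_weight_def ij walk_pos_append(2))
  qed
  finally show ?thesis
    by (simp add: gessel_poly_def sum.distrib sum_subtractf sum_distrib_left)
qed

lemma gessel_poly_0: "gessel_poly 0 x y = 1"
proof -
  have "gessel_walks 0 = {[]}" by (auto simp: gessel_walks_def walk_pos_def)
  then show ?thesis by (simp add: gessel_poly_def walk_weight_def walk_pos_def)
qed

text \<open>Group the walks by end point; each step raises a coordinate by at most 1, so both
  coordinates of the end point are at most k.\<close>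

lemma gessel_poly_eq:
  "gessel_poly k x y = (\<Sum>i\<le>k. \<Sum>j\<le>k. of_nat (gessel_q i j k) * x ^ i * y ^ j)"
proof -
  define e where "e w = (nat (fst (walk_pos w k)), nat (snd (walk_pos w k)))" for w
  have "e ` gessel_walks k \<subseteq> {..k} \<times> {..k}"
    using walk_pos_le by (fastforce simp: e_def gessel_walks_def)
  then have "gessel_poly k x y =
      (\<Sum>p\<in>{..k} \<times> {..k}. \<Sum>w | w \<in> gessel_walks k \<and> e w = p. walk_weight x y w)"
    unfolding gessel_poly_def
    by (intro sum.group[symmetric]) (auto simp: finite_gessel_walks)
  also have "\<dots> = (\<Sum>(i, j)\<in>{..k} \<times> {..k}. of_nat (gessel_q i j k) * x ^ i * y ^ j)"
  proof (rule sum.cong[OF refl], clarify)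
    fix i j
    have eq: "{w. w \<in> gessel_walks k \<and> e w = (i, j)} = {w. length w = k \<and> set w \<subseteq> gessel_steps
      \<and> (\<forall>n\<le>k. fst (walk_pos w n) \<ge> 0 \<and> snd (walk_pos w n) \<ge> 0)
      \<and> walk_pos w k = (int i, int j)}"
      by (auto simp: gessel_walks_def e_def prod_eq_iff)
    have "(\<Sum>w | w \<in> gessel_walks k \<and> e w = (i, j). walk_weight x y w) =
        (\<Sum>w | w \<in> gessel_walks k \<and> e w = (i, j). x ^ i * y ^ j)"
      by (rule sum.cong) (auto simp: e_def walk_weight_def gessel_walks_def)
    then show "(\<Sum>w | w \<in> gessel_walks k \<and> e w = (i, j). walk_weight x y w) =
        of_nat (gessel_q i j k) * x ^ i * y ^ j"
      by (simp add: eq gessel_q_def)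
  qed
  finally show ?thesis by (simp add: sum.cartesian_product)
qed

section \<open>Convergence, the functional equation for Q, and holomorphy\<close>

lemma norm_gessel_poly_le:
  assumes "norm x \<le> 1" "norm y \<le> 1"
  shows "norm (gessel_poly k x y) \<le> 4 ^ k"
proof -
  have "norm (gessel_poly k x y) \<le> of_nat (card (gessel_walks k)) * 1"
    unfolding gessel_poly_def using assms
    by (intro sum_norm_bound)
       (auto simp: walk_weight_def norm_mult norm_power intro!: mult_le_one power_le_one)
  also have "\<dots> \<le> 4 ^ k" using card_gessel_walks[of k]
    by (metis mult.right_neutral of_nat_le_iff of_nat_numeral of_nat_power)
  finally show ?thesis .
qed

lemma gessel_Q_eq: "gessel_Q x y z = (\<Sum>k. gessel_poly k x y * z ^ k)"
  by (simp add: gessel_Q_def gessel_poly_eq sum_distrib_right)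

lemma gessel_poly_majorant:
  fixes z :: real
  assumes "norm x \<le> 1" "norm y \<le> 1" "0 < z"
  shows "norm (gessel_poly k x y * of_real z ^ k) \<le> (4 * z) ^ k"
  using norm_gessel_poly_le[OF assms(1,2), of k] assms(3)
  by (simp add: norm_mult norm_power power_mult_distrib mult_right_mono)

lemma gessel_sums:
  fixes z :: real
  assumes "norm x \<le> 1" "norm y \<le> 1" "0 < z" "z < 1/4"
  shows "(\<lambda>k. gessel_poly k x y * of_real z ^ k) sums gessel_Q x y (of_real z)"
proof -
  have "summable (\<lambda>k. (4 * z) ^ k)" using assms by (intro summable_geometric) auto
  then have "summable (\<lambda>k. gessel_poly k x y * of_real z ^ k)"
    by (rule summable_comparison_test') (rule gessel_poly_majorant[OF assms(1-3)])
  then show ?thesis by (simp add: gessel_Q_eq summable_sums)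
qed

text \<open>The recursion for \<open>gessel_poly\<close>, multiplied by z^(k+1) and summed over k.
  The kernel is z (y + 1 + x^2 y + x^2 y^2) - x y: the first part comes from the four steps, the
  second from the left side of the recursion.\<close>

lemma gessel_functional_equation:
  fixes z :: real and x y :: complex
  assumes x: "norm x \<le> 1" and y: "norm y \<le> 1" and z: "0 < z" "z < 1/4"
  shows "(kat z y * x\<^sup>2 + kbt z y * x + kct z y) * gessel_Q x y z =
    z * gessel_Q x 0 z + z * (y + 1) * gessel_Q 0 y z - z * gessel_Q 0 0 z - x * y"
proof -
  let ?p = "\<lambda>x y k. gessel_poly k x y * of_real z ^ k"
  note s = gessel_sums[OF _ _ z]
  \<comment> \<open>The shifted series misses the term k = 0, which is 1 for the empty walk; it
    produces the term - x y of the equation.\<close>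
  have lhs: "(\<lambda>k. x * y * ?p x y (Suc k)) sums (x * y * (gessel_Q x y z - 1))"
    using s[OF x y] sums_Suc_iff[of "?p x y" "gessel_Q x y z - 1"]
    by (intro sums_mult) (simp add: gessel_poly_0)
  have rec: "x * y * ?p x y (Suc k) =
     z * ((y + 1 + x\<^sup>2 * y + x\<^sup>2 * y\<^sup>2) * ?p x y k - (y + 1) * ?p 0 y k - ?p x 0 k + ?p 0 0 k)" for k
  proof -
    have "x * y * ?p x y (Suc k) = (x * y * gessel_poly (Suc k) x y) * of_real z ^ Suc k" by simp
    then show ?thesis unfolding gessel_poly_Suc by (simp add: algebra_simps)
  qed
  have rhs: "(\<lambda>k. z * ((y + 1 + x\<^sup>2 * y + x\<^sup>2 * y\<^sup>2) * ?p x y k - (y + 1) * ?p 0 y k - ?p x 0 k + ?p 0 0 k))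
    sums (z * ((y + 1 + x\<^sup>2 * y + x\<^sup>2 * y\<^sup>2) * gessel_Q x y z - (y + 1) * gessel_Q 0 y z
            - gessel_Q x 0 z + gessel_Q 0 0 z))"
    using x y by (intro sums_mult sums_add sums_diff s) auto
  have "x * y * (gessel_Q x y z - 1) =
     z * ((y + 1 + x\<^sup>2 * y + x\<^sup>2 * y\<^sup>2) * gessel_Q x y z - (y + 1) * gessel_Q 0 y z
            - gessel_Q x 0 z + gessel_Q 0 0 z)"
    by (rule sums_unique2[OF lhs[unfolded rec] rhs])
  then show ?thesis
    unfolding kat_def kbt_def kct_def by (simp add: algebra_simps power2_eq_square)
qed

lemma holomorphic_gessel_poly:
  assumes "f holomorphic_on S" "g holomorphic_on S"
  shows "(\<lambda>t. gessel_poly k (f t) (g t)) holomorphic_on S"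
  unfolding gessel_poly_def walk_weight_def by (intro holomorphic_intros assms)

text \<open>The majorant (4z)^k makes the partial sums converge uniformly. Arguments
  \<open>f\<close> and \<open>g\<close> of a single variable cover both boundary series Q(x,0,z) and
  Q(0,y,z).\<close>

lemma holomorphic_gessel_Q:
  fixes z :: real
  assumes S: "open S" and f: "f holomorphic_on S" "\<And>t. t \<in> S \<Longrightarrow> norm (f t) \<le> 1"
    and g: "g holomorphic_on S" "\<And>t. t \<in> S \<Longrightarrow> norm (g t) \<le> 1" and z: "0 < z" "z < 1/4"
  shows "(\<lambda>t. gessel_Q (f t) (g t) z) holomorphic_on S"
proof (rule holomorphic_uniform_sequence[OF S])
  show "(\<lambda>t. \<Sum>k<n. gessel_poly k (f t) (g t) * of_real z ^ k) holomorphic_on S" for n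
    by (intro holomorphic_intros holomorphic_gessel_poly f g)
  have "summable (\<lambda>k. (4 * z) ^ k)" using z by (intro summable_geometric) auto
  then have u: "uniform_limit S (\<lambda>n t. \<Sum>k<n. gessel_poly k (f t) (g t) * of_real z ^ k)
      (\<lambda>t. gessel_Q (f t) (g t) z) sequentially"
    unfolding gessel_Q_eq
    by (rule Weierstrass_m_test[rotated]) (intro gessel_poly_majorant f g z; assumption)
  fix t assume "t \<in> S"
  then obtain d where "d > 0" "cball t d \<subseteq> S" using S open_contains_cball by blast
  then show "\<exists>d>0. cball t d \<subseteq> S \<and> uniform_limit (cball t d)
      (\<lambda>n t. \<Sum>k<n. gessel_poly k (f t) (g t) * of_real z ^ k) (\<lambda>t. gessel_Q (f t) (g t) z) sequentially"
    using uniform_limit_on_subset[OF u] by blast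
qed

section \<open>Quadratic equations with roots of distinct modulus\<close>

text \<open>This says that $A X^2 + B X + C$ has two roots of distinct modulus, one of them possibly
  at infinity or at 0: $|r_1| = |r_2|$ amounts to $B^2 / (4 A C) \<in> [0, 1]$.\<close>

definition split_quadratic :: "complex \<Rightarrow> complex \<Rightarrow> complex \<Rightarrow> bool" where
  "split_quadratic A B C \<longleftrightarrow> B \<noteq> 0 \<and> 1 - 4 * A * C / B\<^sup>2 \<notin> \<real>\<^sub>\<le>\<^sub>0"

lemma Re_csqrt_pos: "w \<notin> \<real>\<^sub>\<le>\<^sub>0 \<Longrightarrow> Re (csqrt w) > 0"
proof (rule ccontr)
  assume w: "w \<notin> \<real>\<^sub>\<le>\<^sub>0" "\<not> Re (csqrt w) > 0"
  then have r: "Re (csqrt w) = 0" using csqrt_principal[of w] by auto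
  have "w = (csqrt w)\<^sup>2" by simp
  also have "\<dots> = - of_real ((Im (csqrt w))\<^sup>2)"
    using r by (simp add: complex_eq_iff power2_eq_square)
  finally have "w = of_real (- ((Im (csqrt w))\<^sup>2))" by simp
  then have "w \<in> \<real>\<^sub>\<le>\<^sub>0" by (metis nonpos_Reals_of_real_iff neg_le_0_iff_le zero_le_power2)
  with w show False by simp
qed

text \<open>The squared moduli differ by 4 Re s.\<close>

lemma norm_diff_less_add:
  assumes "Re s > 0"
  shows "norm (1 - s) < norm (1 + s)"
proof -
  have "(norm (1 - s))\<^sup>2 < (norm (1 + s))\<^sup>2"
    using assms by (simp only: cmod_power2) (simp add: power2_eq_square algebra_simps)
  then show ?thesis by (simp add: power2_less_imp_less)
qed

text \<open>Here s is a square root of the discriminant divided by B, so the roots are -B (1 - s) /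
  (2 A) and -B (1 + s) / (2 A). After this normalisation Re s > 0 tells which root is smaller,
  whereas \<open>csqrt\<close> of the discriminant itself fixes it only up to a sign.\<close>

lemma split_quadratic_csqrt:
  assumes "split_quadratic A B C"
  obtains s where "s = csqrt (1 - 4 * A * C / B\<^sup>2)" "Re s > 0" "1 + s \<noteq> 0" "4 * A * C = B\<^sup>2 * (1 - s\<^sup>2)"
proof
  let ?s = "csqrt (1 - 4 * A * C / B\<^sup>2)"
  show "?s = ?s" ..
  show p: "Re ?s > 0" using assms by (intro Re_csqrt_pos) (simp add: split_quadratic_def)
  show "1 + ?s \<noteq> 0"
  proof
    assume "1 + ?s = 0"
    then have "Re (1 + ?s) = 0" by simp
    with p show False by (simp del: csqrt.simps)
  qed
  show "4 * A * C = B\<^sup>2 * (1 - ?s\<^sup>2)" using assms by (simp add: split_quadratic_def)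
qed

text \<open>By |1 - s| < |1 + s| the small root is -B (1 - s) / (2 A). Rationalising moves A out of
  the denominator, so that A = 0, where s = 1, gives the root -C / B by the same formula.\<close>

lemma small_root_eq:
  assumes "split_quadratic A B C"
  shows "small_root A B C = - 2 * C / (B * (1 + csqrt (1 - 4 * A * C / B\<^sup>2)))"
proof (cases "A = 0")
  case True
  then show ?thesis by (simp add: small_root_def)
next
  case False
  obtain s where s: "s = csqrt (1 - 4 * A * C / B\<^sup>2)" "Re s > 0" "1 + s \<noteq> 0"
    "4 * A * C = B\<^sup>2 * (1 - s\<^sup>2)"
    using split_quadratic_csqrt[OF assms] .
  have B: "B \<noteq> 0" using assms by (simp add: split_quadratic_def)
  have lt: "norm (B * (1 - s) / (2 * A)) < norm (B * (1 + s) / (2 * A))"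
    using B False norm_diff_less_add[OF s(2)]
    by (simp add: norm_mult norm_divide divide_strict_right_mono)
  have eq: "- 2 * C / (B * (1 + s)) = - (B * (1 - s) / (2 * A))"
  proof -
    have "- 2 * C / (B * (1 + s)) = - (4 * A * C) / (2 * A * B * (1 + s))"
      using False by simp
    also have "\<dots> = - (B\<^sup>2 * ((1 - s) * (1 + s))) / (2 * A * B * (1 + s))"
      unfolding s(4) by (simp add: power2_eq_square algebra_simps)
    finally show ?thesis using s(3) B by (simp add: power2_eq_square)
  qed
  \<comment> \<open>The principal root of the discriminant is B s or -B s; the sign only exchanges
    the two candidates \<open>r1\<close> and \<open>r2\<close>, and comparing moduli picks the same
    root.\<close>
  have "(csqrt (B\<^sup>2 - 4 * A * C))\<^sup>2 = (B * s)\<^sup>2"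
    using s(4) by (simp add: algebra_simps power_mult_distrib)
  then have "csqrt (B\<^sup>2 - 4 * A * C) = B * s \<or> csqrt (B\<^sup>2 - 4 * A * C) = - (B * s)"
    by (simp only: power2_eq_iff)
  then have "small_root A B C = - (B * (1 - s) / (2 * A))"
  proof
    assume r: "csqrt (B\<^sup>2 - 4 * A * C) = B * s"
    have "- B + B * s = - (B * (1 - s))" "- B - B * s = - (B * (1 + s))" by (auto simp: algebra_simps)
    then show ?thesis using lt False
      unfolding small_root_def Let_def r by (simp only: minus_divide_left[symmetric] norm_minus_cancel) simp
  next
    assume r: "csqrt (B\<^sup>2 - 4 * A * C) = - (B * s)"
    have "- B + - (B * s) = - (B * (1 + s))" "- B - - (B * s) = - (B * (1 - s))" by (auto simp: algebra_simps)
    then show ?thesis using lt False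
      unfolding small_root_def Let_def r by (simp only: minus_divide_left[symmetric] norm_minus_cancel) simp
  qed
  then show ?thesis using eq s(1) by simp
qed

text \<open>For A and C nonzero the roots have product C / A, so A r^2 / C is the ratio of the small
  root to the large one, namely (1 - s) / (1 + s). This form of the inequality still makes sense
  when the large root is at infinity.\<close>

lemma small_root_root:
  assumes "split_quadratic A B C"
  shows "A * (small_root A B C)\<^sup>2 + B * small_root A B C + C = 0"
    and "C \<noteq> 0 \<Longrightarrow> norm (A * (small_root A B C)\<^sup>2) < norm C"
proof -
  obtain s where s: "s = csqrt (1 - 4 * A * C / B\<^sup>2)" "Re s > 0" "1 + s \<noteq> 0"
    "4 * A * C = B\<^sup>2 * (1 - s\<^sup>2)"
    using split_quadratic_csqrt[OF assms] .
  have B: "B \<noteq> 0" using assms by (simp add: split_quadratic_def)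
  have r: "small_root A B C = - 2 * C / (B * (1 + s))" using small_root_eq[OF assms] s(1) by simp
  have "A * (small_root A B C)\<^sup>2 = (4 * A * C) * C / (B\<^sup>2 * (1 + s)\<^sup>2)"
    unfolding r by (simp add: power2_eq_square ac_simps)
  also have "\<dots> = (1 - s\<^sup>2) * C / (1 + s)\<^sup>2" unfolding s(4) using B by simp
  also have "\<dots> = C * ((1 - s) / (1 + s))"
    using s(3) square_diff_one_factored[of s] by (simp add: power2_eq_square square_diff_square_factored[of 1 s, simplified] ac_simps)
  finally have A: "A * (small_root A B C)\<^sup>2 = C * ((1 - s) / (1 + s))" .
  show "A * (small_root A B C)\<^sup>2 + B * small_root A B C + C = 0"
  proof -
    have "B * small_root A B C = - (2 * C / (1 + s))" unfolding r using B by simp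
    then show ?thesis unfolding A using s(3) by (simp add: field_simps)
  qed
  have "norm ((1 - s) / (1 + s)) < 1"
    using norm_diff_less_add[OF s(2)] s(3) by (simp add: norm_divide)
  then show "C \<noteq> 0 \<Longrightarrow> norm (A * (small_root A B C)\<^sup>2) < norm C"
    unfolding A norm_mult by simp
qed

text \<open>A converse to the previous lemma: the strict inequality alone forces distinct moduli and
  identifies the root. The ratio q = A r^2 / C determines the normalised square root of the
  discriminant by inverting q = (1 - s) / (1 + s).\<close>

lemma small_root_unique:
  assumes r: "A * r\<^sup>2 + B * r + C = 0" and lt: "norm (A * r\<^sup>2) < norm C"
  shows "split_quadratic A B C" and "small_root A B C = r"
proof -
  have C: "C \<noteq> 0" using lt by auto
  define q where "q = A * r\<^sup>2 / C"
  have q: "norm q < 1" using lt C by (simp add: q_def norm_divide)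
  then have q1: "1 + q \<noteq> 0" by (metis add_eq_0_iff norm_minus_cancel norm_one less_irrefl)
  have Aq: "A * r\<^sup>2 = q * C" using C by (simp add: q_def)
  have "B * r = - C - A * r\<^sup>2" using arg_cong[OF r, of "\<lambda>t. t - C - A * r\<^sup>2"] by (simp add: algebra_simps)
  then have Br: "B * r = - C * (1 + q)" unfolding Aq by (simp add: algebra_simps)
  then have nz: "B \<noteq> 0" "r \<noteq> 0" using C q1 by auto
  \<comment> \<open>The Cayley transform sends the unit disc to the right half-plane, so p is the
    principal square root of its square, which is the normalised discriminant.\<close>
  define p where "p = (1 - q) / (1 + q)"
  have "Re p > 0"
  proof -
    have "Re p = (1 - (norm q)\<^sup>2) / (norm (1 + q))\<^sup>2"
      by (simp only: p_def cmod_power2 Re_divide) (simp add: power2_eq_square algebra_simps)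
    moreover have "(norm q)\<^sup>2 < 1" using q by (simp add: abs_square_less_1)
    ultimately show ?thesis using q1 by simp
  qed
  have "4 * A * C / B\<^sup>2 = 4 * (A * r\<^sup>2) * C / (B * r)\<^sup>2"
    using nz by (simp add: power_mult_distrib)
  also have "\<dots> = 4 * (q * C) * C / (C * (1 + q))\<^sup>2" unfolding Br Aq by (simp only: power2_eq_square minus_mult_minus mult_minus_left) simp
  also have "\<dots> = 4 * q / (1 + q)\<^sup>2" using C by (simp add: power2_eq_square)
  finally have D: "1 - 4 * A * C / B\<^sup>2 = p\<^sup>2"
  proof (simp only:)
    have "1 - 4 * q / (1 + q)\<^sup>2 = ((1 + q)\<^sup>2 - 4 * q) / (1 + q)\<^sup>2"
      using q1 by (simp add: diff_divide_distrib)
    also have "(1 + q)\<^sup>2 - 4 * q = (1 - q)\<^sup>2" by (simp add: power2_eq_square algebra_simps)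
    finally show "1 - 4 * q / (1 + q)\<^sup>2 = p\<^sup>2" by (simp add: p_def power_divide)
  qed
  have cs: "csqrt (p\<^sup>2) = p" using \<open>Re p > 0\<close> by (intro csqrt_square) auto
  have "p\<^sup>2 \<notin> \<real>\<^sub>\<le>\<^sub>0"
  proof
    assume "p\<^sup>2 \<in> \<real>\<^sub>\<le>\<^sub>0"
    then have "Im p = 0" "(Re p)\<^sup>2 \<le> (Im p)\<^sup>2"
      using \<open>Re p > 0\<close> by (auto simp: complex_nonpos_Reals_iff power2_eq_square)
    then show False using \<open>Re p > 0\<close> by simp
  qed
  then show sq: "split_quadratic A B C" using nz D by (simp add: split_quadratic_def)
  have "1 + p = 2 / (1 + q)" unfolding p_def using q1 by (simp add: field_simps)
  then have "small_root A B C = - C * (1 + q) / B"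
    unfolding small_root_eq[OF sq] D cs using q1 by simp
  then show "small_root A B C = r"
    unfolding Br[symmetric] using nz by simp
qed

text \<open>The choice by moduli in \<open>small_root\<close> agrees with one closed formula, in
  which \<open>csqrt\<close> is evaluated off its cut and the denominator does not vanish.\<close>

lemma holomorphic_small_root:
  assumes "A holomorphic_on S" "B holomorphic_on S" "C holomorphic_on S"
    and "\<And>t. t \<in> S \<Longrightarrow> split_quadratic (A t) (B t) (C t)"
  shows "(\<lambda>t. small_root (A t) (B t) (C t)) holomorphic_on S"
proof -
  have nz: "1 + csqrt (1 - 4 * A t * C t / (B t)\<^sup>2) \<noteq> 0" if "t \<in> S" for t
    using split_quadratic_csqrt[OF assms(4)[OF that]] by metis
  have "(\<lambda>t. - 2 * C t / (B t * (1 + csqrt (1 - 4 * A t * C t / (B t)\<^sup>2)))) holomorphic_on S"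
    using assms(4) nz by (intro holomorphic_intros assms) (auto simp: split_quadratic_def)
  then show ?thesis
    by (rule holomorphic_transform) (simp add: small_root_eq assms(4))
qed

lemma not_split_quadraticE:
  assumes "\<not> split_quadratic A B C"
  obtains \<tau> where "0 \<le> \<tau>" "\<tau> \<le> 1" "B\<^sup>2 = 4 * of_real \<tau> * (A * C)"
proof (cases "B = 0")
  case True
  then show ?thesis using that[of 0] by auto
next
  case False
  then have "1 - 4 * A * C / B\<^sup>2 \<in> \<real>\<^sub>\<le>\<^sub>0" using assms by (simp add: split_quadratic_def)
  then obtain r where r: "r \<le> 0" "1 - 4 * A * C / B\<^sup>2 = of_real r"
    by (auto elim: nonpos_Reals_cases)
  define k where "k = 1 - r"
  have k: "k \<ge> 1" "4 * A * C / B\<^sup>2 = of_real k" using r by (auto simp: k_def algebra_simps)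
  have "4 * A * C = of_real k * B\<^sup>2" using k(2) False by (simp add: field_simps)
  then have "4 * of_real (1 / k) * (A * C) = B\<^sup>2" using k(1) by (simp add: field_simps)
  then show ?thesis using k(1) that[of "1 / k"] by auto
qed

section \<open>The branch cuts\<close>

text \<open>If w + 1/w is real, then w is real or |w| = 1. In the second case the sum is 2 Re w, at
  most 2, which T > 2 excludes.\<close>

lemma add_inverse_eq_real:
  fixes w :: complex
  assumes "w \<noteq> 0" "w + 1 / w = of_real T" "T > 2"
  obtains t where "t > 0" "w = of_real t" "t + 1 / t = T"
proof -
  define n where "n = (Re w)\<^sup>2 + (Im w)\<^sup>2"
  have n: "n > 0" using assms(1) by (simp add: n_def complex_neq_0)
  have "Re (w + 1 / w) = T" "Im (w + 1 / w) = 0" using assms(2) by simp_all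
  then have eq: "Re w + Re w / n = T" "Im w - Im w / n = 0"
    by (simp_all add: Re_divide Im_divide n_def)
  have "Im w = 0"
  proof (rule ccontr)
    assume "Im w \<noteq> 0"
    then have "n = 1" using eq(2) n by (simp add: field_simps)
    then have "2 * Re w = T" using eq(1) by simp
    moreover have "(Re w)\<^sup>2 \<le> 1" using \<open>n = 1\<close> by (simp add: n_def) (metis le_add_same_cancel1 zero_le_power2)
    ultimately show False using assms(3) abs_square_le_1[of "Re w"] by auto
  qed
  then have w: "w = of_real (Re w)" by (simp add: complex_eq_iff)
  have "Re w * (1 + 1 / n) = T" using eq(1) by (simp add: algebra_simps)
  then have "Re w > 0" using assms(3) n
    by (metis add_pos_pos divide_pos_pos less_trans zero_less_mult_pos2 zero_less_numeral zero_less_one)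
  moreover have "Re w + 1 / Re w = T" using eq(1) \<open>Im w = 0\<close> \<open>Re w > 0\<close>
    by (simp add: n_def power2_eq_square)
  ultimately show ?thesis using that w by blast
qed

section \<open>The boundary series and the candidates for their continuations\<close>

definition x_series :: "real \<Rightarrow> complex \<Rightarrow> complex" where
  "x_series z x = of_real z * gessel_Q x 0 (of_real z)"

definition y_series :: "real \<Rightarrow> complex \<Rightarrow> complex" where
  "y_series z y = of_real z * (y + 1) * gessel_Q 0 y (of_real z)"

text \<open>Outside the disc the value is the one that the functional equation dictates at the
  kernel point (x, \<open>Y0 z x\<close>).\<close>

definition x_continuation :: "real \<Rightarrow> complex \<Rightarrow> complex" where
  "x_continuation z x = (if norm x < 1 then x_series z x
     else z * gessel_Q 0 0 z + x * Y0 z x - y_series z (Y0 z x))"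

definition y_continuation :: "real \<Rightarrow> complex \<Rightarrow> complex" where
  "y_continuation z y = (if norm y < 1 then y_series z y
     else z * gessel_Q 0 0 z + X0 z y * y - x_series z (X0 z y))"

section \<open>Position of the branch points; roots of equal modulus occur only on the cuts\<close>

context
  fixes z :: real
  assumes z: "0 < z" "z < 1/4"
begin

text \<open>As 4 a c = (2 z t)^2, the discriminant d is (b + 2 z t) (b - 2 z t). This is the factor
  b + 2 z t; \<open>x14_factor\<close> treats b - 2 z t.\<close>

lemma x23_factor: "z * ((t - x2 z) * (t - x3 z)) = z * t\<^sup>2 - (1 - 2 * z) * t + z"
proof -
  have s: "(sqrt (1 - 4 * z))\<^sup>2 = 1 - 4 * z" using z by simp
  have "4 * z * (z * ((t - x2 z) * (t - x3 z))) =
      (2 * z * t - (1 - 2 * z) + sqrt (1 - 4 * z)) * (2 * z * t - (1 - 2 * z) - sqrt (1 - 4 * z))"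
    using z by (simp add: x2_def x3_def field_simps)
  also have "\<dots> = (2 * z * t - (1 - 2 * z))\<^sup>2 - (sqrt (1 - 4 * z))\<^sup>2"
    by (simp add: power2_eq_square algebra_simps)
  also have "\<dots> = 4 * z * (z * t\<^sup>2 - (1 - 2 * z) * t + z)"
    unfolding s by (simp add: power2_eq_square algebra_simps)
  finally show ?thesis using z by simp
qed

lemma x14_factor: "z * ((t - x1 z) * (t - x4 z)) = z * t\<^sup>2 - (1 + 2 * z) * t + z"
proof -
  have s: "(sqrt (1 + 4 * z))\<^sup>2 = 1 + 4 * z" using z by simp
  have "4 * z * (z * ((t - x1 z) * (t - x4 z))) =
      (2 * z * t - (1 + 2 * z) + sqrt (1 + 4 * z)) * (2 * z * t - (1 + 2 * z) - sqrt (1 + 4 * z))"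
    using z by (simp add: x1_def x4_def field_simps)
  also have "\<dots> = (2 * z * t - (1 + 2 * z))\<^sup>2 - (sqrt (1 + 4 * z))\<^sup>2"
    by (simp add: power2_eq_square algebra_simps)
  also have "\<dots> = 4 * z * (z * t\<^sup>2 - (1 + 2 * z) * t + z)"
    unfolding s by (simp add: power2_eq_square algebra_simps)
  finally show ?thesis using z by simp
qed

text \<open>The discriminant in y is -y times this quadratic; the factor y accounts for the branch
  point 0.\<close>

lemma y23_factor: "4 * z\<^sup>2 * ((t - y2 z) * (t - y3 z)) = 4 * z\<^sup>2 * (t + 1)\<^sup>2 - t"
proof -
  have z2: "z\<^sup>2 < 1 / 16" using power_strict_mono[of z "1/4" 2] z by (simp add: power2_eq_square)
  then have s: "(sqrt (1 - 16 * z\<^sup>2))\<^sup>2 = 1 - 16 * z\<^sup>2" by simp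
  have "16 * z\<^sup>2 * (4 * z\<^sup>2 * ((t - y2 z) * (t - y3 z))) =
      (8 * z\<^sup>2 * (t - y2 z)) * (8 * z\<^sup>2 * (t - y3 z))"
    by (simp add: algebra_simps)
  also have "8 * z\<^sup>2 * (t - y2 z) = 8 * z\<^sup>2 * t - (1 - 8 * z\<^sup>2) + sqrt (1 - 16 * z\<^sup>2)"
    unfolding y2_def right_diff_distrib[of "8 * z\<^sup>2" t] using z by simp
  also have "8 * z\<^sup>2 * (t - y3 z) = 8 * z\<^sup>2 * t - (1 - 8 * z\<^sup>2) - sqrt (1 - 16 * z\<^sup>2)"
    unfolding y3_def right_diff_distrib[of "8 * z\<^sup>2" t] using z by simp
  also have "(8 * z\<^sup>2 * t - (1 - 8 * z\<^sup>2) + sqrt (1 - 16 * z\<^sup>2)) *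
      (8 * z\<^sup>2 * t - (1 - 8 * z\<^sup>2) - sqrt (1 - 16 * z\<^sup>2)) =
      (8 * z\<^sup>2 * t - (1 - 8 * z\<^sup>2))\<^sup>2 - (sqrt (1 - 16 * z\<^sup>2))\<^sup>2"
    by (simp add: power2_eq_square algebra_simps)
  also have "\<dots> = 16 * z\<^sup>2 * (4 * z\<^sup>2 * (t + 1)\<^sup>2 - t)"
    unfolding s by (simp add: power2_eq_square algebra_simps)
  finally show ?thesis using z by (subst (asm) mult_cancel_left) auto
qed

lemma less_sqrt_unit: "0 < t \<Longrightarrow> t < 1 \<Longrightarrow> t < sqrt t"
  by (rule real_less_rsqrt) (simp add: power2_eq_square)

lemma branch_points_x:
  "\<bar>x1 z\<bar> < 1" "\<bar>x2 z\<bar> < 1" "1 < x3 z" "x3 z \<le> x4 z"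
proof -
  have s: "1 - 4 * z < sqrt (1 - 4 * z)" "sqrt (1 - 4 * z) < 1" using z by (auto intro: less_sqrt_unit)
  have s': "1 < sqrt (1 + 4 * z)" using z by simp
  have "sqrt (1 + 4 * z) < 1 + 2 * z" using z
    by (intro real_less_lsqrt) (auto simp: power2_eq_square algebra_simps)
  then show "\<bar>x1 z\<bar> < 1" using z s' by (simp add: x1_def abs_less_iff field_simps)
  show "\<bar>x2 z\<bar> < 1" using z s by (simp add: x2_def abs_less_iff field_simps)
  show "1 < x3 z" using z s by (simp add: x3_def field_simps)
  show "x3 z \<le> x4 z" unfolding x3_def x4_def using z s s' by (intro divide_right_mono; linarith)
qed

lemma branch_points_y: "0 \<le> y2 z" "y2 z < 1" "1 < y3 z"
proof -
  have z2: "0 < z\<^sup>2" "z\<^sup>2 < 1 / 16"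
    using power_strict_mono[of z "1/4" 2] z by (simp_all add: power2_eq_square)
  have s: "1 - 16 * z\<^sup>2 < sqrt (1 - 16 * z\<^sup>2)" using z2 by (intro less_sqrt_unit) auto
  have "sqrt (1 - 16 * z\<^sup>2) \<le> 1 - 8 * z\<^sup>2" using z2
    by (intro real_le_lsqrt) (auto simp: power2_diff power_mult_distrib)
  then show "0 \<le> y2 z" by (simp add: y2_def)
  show "y2 z < 1" "1 < y3 z" using z2 s by (simp_all add: y2_def y3_def field_simps)
qed

text \<open>If the moduli agree, dividing b^2 = 4 \<tau> a c by (z x)^2 gives x + 1/x = 1/z + \<mu>
  with \<mu> real and |\<mu>| \<le> 2. As 1/z > 4, the right side exceeds 2, so x is real and
  positive, and the signs of the two factors of d put it on a cut.\<close>

lemma split_quadratic_x: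
  assumes "x \<notin> xcut12 z \<union> xcut34 z"
  shows "split_quadratic (ka z x) (kb z x) (kc z x)"
proof (rule ccontr)
  assume "\<not> ?thesis"
  then obtain \<tau> where \<tau>: "0 \<le> \<tau>" "\<tau> \<le> 1" "(kb z x)\<^sup>2 = 4 * of_real \<tau> * (ka z x * kc z x)"
    by (rule not_split_quadraticE)
  have x: "x \<noteq> 0" using \<tau>(3) z by (auto simp: ka_def kb_def)
  define m where "m = x + 1 / x - 1 / z"
  have kb: "kb z x = z * x * m" using x z by (simp add: kb_def m_def field_simps power2_eq_square)
  have "(z * x)\<^sup>2 * m\<^sup>2 = (z * x)\<^sup>2 * (4 * of_real \<tau>)"
    using \<tau>(3) by (simp add: kb ka_def kc_def power_mult_distrib power2_eq_square algebra_simps)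
  then have "m\<^sup>2 = 4 * of_real \<tau>" using x z by simp
  also have "\<dots> = (of_real (2 * sqrt \<tau>))\<^sup>2"
    using \<tau>(1) by (simp add: power_mult_distrib flip: of_real_power)
  finally have "m = of_real (2 * sqrt \<tau>) \<or> m = of_real (- (2 * sqrt \<tau>))"
    by (simp only: power2_eq_iff of_real_minus)
  moreover have "\<bar>2 * sqrt \<tau>\<bar> \<le> 2" "\<bar>- (2 * sqrt \<tau>)\<bar> \<le> 2" using \<tau> by auto
  ultimately obtain \<mu> where \<mu>: "m = of_real \<mu>" "\<bar>\<mu>\<bar> \<le> 2" by blast
  have "x + 1 / x = of_real (1 / z + \<mu>)" using \<mu>(1) by (simp add: m_def algebra_simps)
  moreover have "1 / z > 4" using z by (simp add: field_simps)
  ultimately obtain t where t: "t > 0" "x = of_real t" "t + 1 / t = 1 / z + \<mu>"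
    using add_inverse_eq_real[of x "1 / z + \<mu>"] x \<mu>(2) by (auto simp: abs_le_iff)
  have e: "z * t\<^sup>2 - t + z = \<mu> * (z * t)"
    using t(1,3) z by (simp add: field_simps power2_eq_square)
  have "\<bar>\<mu> * (z * t)\<bar> \<le> 2 * (z * t)"
    using \<mu>(2) z t(1) by (simp add: abs_mult)
  \<comment> \<open>From |b| \<le> 2 z t: b + 2 z t \<ge> 0 keeps t out of the open gap between x2
    and x3, and b - 2 z t \<le> 0 keeps it between x1 and x4.\<close>
  then have "z * ((t - x2 z) * (t - x3 z)) \<ge> 0" "z * ((t - x1 z) * (t - x4 z)) \<le> 0"
    unfolding x23_factor x14_factor using e by (simp_all add: algebra_simps abs_le_iff)
  then have "(t - x2 z) * (t - x3 z) \<ge> 0" "(t - x1 z) * (t - x4 z) \<le> 0"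
    using z by (simp_all add: zero_le_mult_iff mult_le_0_iff)
  then have "t \<in> closed_segment (x1 z) (x2 z) \<union> closed_segment (x3 z) (x4 z)"
    using branch_points_x
    by (auto simp: closed_segment_eq_real_ivl zero_le_mult_iff mult_le_0_iff abs_less_iff split: if_splits)
  then show False
    using assms t(2) by (auto simp: xcut12_def xcut34_def closed_segment_of_real)
qed

lemma ycut12_eq: "ycut12 z = of_real ` {0..y2 z}"
  unfolding ycut12_def closed_segment_of_real
  using branch_points_y(1) by (simp add: y1_def closed_segment_eq_real_ivl)

text \<open>Equal moduli would give y = 4 \<tau> z^2 (y + 1)^2, the point y = 0 being on the cut.
  Hence y + 1/y is a real number above 2, y is positive, and \<tau> \<le> 1 gives the sign of the
  quadratic in \<open>y23_factor\<close>.\<close>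

lemma split_quadratic_y:
  assumes "y \<notin> ycut12 z \<union> ycut34 z"
  shows "split_quadratic (kat z y) (kbt z y) (kct z y)"
proof (rule ccontr)
  assume "\<not> ?thesis"
  then obtain \<tau> where \<tau>: "0 \<le> \<tau>" "\<tau> \<le> 1" "(kbt z y)\<^sup>2 = 4 * of_real \<tau> * (kat z y * kct z y)"
    by (rule not_split_quadraticE)
  have y: "y \<noteq> 0" using assms by (auto simp: ycut12_def y1_def)
  have "y * y = 4 * of_real \<tau> * (z * y * (y + 1) * (z * (y + 1)))"
    using \<tau>(3) by (simp add: kbt_def kat_def kct_def power2_eq_square)
  also have "\<dots> = y * (4 * of_real \<tau> * z\<^sup>2 * (y + 1)\<^sup>2)"
    by (simp add: power2_eq_square)
  finally have e: "y = 4 * of_real \<tau> * z\<^sup>2 * (y + 1)\<^sup>2" using y by (metis mult_left_cancel)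
  then have "\<tau> \<noteq> 0" using y by auto
  define T where "T = 1 / (4 * \<tau> * z\<^sup>2) - 2"
  have "(y + 1)\<^sup>2 / y = of_real (1 / (4 * \<tau> * z\<^sup>2))"
    using e \<open>\<tau> \<noteq> 0\<close> y z by (simp add: field_simps)
  moreover have "(y + 1)\<^sup>2 / y = y + 1 / y + 2" using y by (simp add: field_simps power2_eq_square)
  ultimately have "y + 1 / y = of_real T" by (simp add: T_def algebra_simps)
  moreover have "T > 2"
  proof -
    have "16 * z\<^sup>2 < 1" using power_strict_mono[of z "1/4" 2] z by (simp add: power2_eq_square)
    moreover have "16 * (\<tau> * z\<^sup>2) \<le> 16 * z\<^sup>2" using \<tau> by (simp add: mult_left_le_one_le)
    moreover have "\<tau> * z\<^sup>2 > 0" using \<tau> \<open>\<tau> \<noteq> 0\<close> z by simp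
    ultimately show ?thesis by (simp add: T_def field_simps)
  qed
  ultimately obtain t where t: "t > 0" "y = of_real t" using add_inverse_eq_real y by metis
  have "of_real t = (of_real (4 * \<tau> * z\<^sup>2 * (t + 1)\<^sup>2) :: complex)" using e t(2) by simp
  then have "t = \<tau> * (4 * z\<^sup>2 * (t + 1)\<^sup>2)" by (simp only: of_real_eq_iff ac_simps)
  also have "\<dots> \<le> 4 * z\<^sup>2 * (t + 1)\<^sup>2" using \<tau> by (intro mult_left_le_one_le) auto
  finally have "4 * z\<^sup>2 * ((t - y2 z) * (t - y3 z)) \<ge> 0" unfolding y23_factor by simp
  then have "(t - y2 z) * (t - y3 z) \<ge> 0" using z by (simp add: zero_le_mult_iff)
  then have "t \<le> y2 z \<or> y3 z \<le> t" by (auto simp: zero_le_mult_iff)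
  then show False
    using assms t by (auto simp: ycut12_eq ycut34_def)
qed

lemma norm_less_1_xcut12:
  assumes "x \<in> xcut12 z"
  shows "norm x < 1"
proof -
  obtain t where "x = of_real t" "t \<in> closed_segment (x1 z) (x2 z)"
    using assms by (auto simp: xcut12_def closed_segment_of_real)
  then show ?thesis using branch_points_x
    by (auto simp: closed_segment_eq_real_ivl abs_less_iff split: if_splits)
qed

lemma norm_less_1_ycut12:
  assumes "y \<in> ycut12 z"
  shows "norm y < 1"
  using assms branch_points_y by (auto simp: ycut12_eq)

lemma closed_ycut34: "closed (ycut34 z)"
proof -
  have "ycut34 z = {w. Im w = 0} \<inter> {w. Re w \<ge> y3 z}"
    by (auto simp: ycut34_def complex_eq_iff)
  moreover have "closed {w. Im w = 0}" by (intro closed_Collect_eq continuous_intros)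
  ultimately show ?thesis by (simp add: closed_Int closed_halfspace_Re_ge)
qed

section \<open>Branches of the kernel\<close>

lemma kernel_swap:
  "kat z y * x\<^sup>2 + kbt z y * x + kct z y = ka z x * y\<^sup>2 + kb z x * y + kc z x"
  by (simp add: kat_def kbt_def kct_def ka_def kb_def kc_def algebra_simps power2_eq_square)

lemma Y0_root:
  assumes "split_quadratic (ka z x) (kb z x) (kc z x)"
  shows "ka z x * (Y0 z x)\<^sup>2 + kb z x * Y0 z x + kc z x = 0" and "norm (x * Y0 z x) < 1"
proof -
  show "ka z x * (Y0 z x)\<^sup>2 + kb z x * Y0 z x + kc z x = 0"
    using small_root_root(1)[OF assms] by (simp add: Y0_def)
  have "norm (ka z x * (Y0 z x)\<^sup>2) < norm (kc z x)"
    using small_root_root(2)[OF assms] z by (simp add: Y0_def kc_def)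
  then have "z * (norm (x * Y0 z x))\<^sup>2 < z * 1"
    using z by (simp add: ka_def kc_def norm_mult norm_power power_mult_distrib)
  then show "norm (x * Y0 z x) < 1" using z by (simp add: abs_square_less_1)
qed

text \<open>Used at x = \<open>X0 z y\<close>, a point whose position relative to the cuts in x is
  not known.\<close>

lemma Y0_unique:
  assumes "ka z x * y\<^sup>2 + kb z x * y + kc z x = 0" "norm (x * y) < 1"
  shows "split_quadratic (ka z x) (kb z x) (kc z x)" and "Y0 z x = y"
proof -
  have "(norm (x * y))\<^sup>2 < 1" using assms(2) by (simp add: abs_square_less_1)
  then have "norm (ka z x * y\<^sup>2) < norm (kc z x)"
    using z by (simp add: ka_def kc_def norm_mult norm_power power_mult_distrib mult.assoc)
  from small_root_unique[OF assms(1) this]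
  show "split_quadratic (ka z x) (kb z x) (kc z x)" and "Y0 z x = y" by (auto simp: Y0_def)
qed

lemma X0_minus_1: "X0 z (-1) = 0"
  by (simp add: X0_def small_root_def kat_def kct_def)

lemma X0_root:
  assumes "split_quadratic (kat z y) (kbt z y) (kct z y)"
  shows "kat z y * (X0 z y)\<^sup>2 + kbt z y * X0 z y + kct z y = 0" and "norm ((X0 z y)\<^sup>2 * y) < 1"
proof -
  show "kat z y * (X0 z y)\<^sup>2 + kbt z y * X0 z y + kct z y = 0"
    using small_root_root(1)[OF assms] by (simp add: X0_def)
  show "norm ((X0 z y)\<^sup>2 * y) < 1"
  proof (cases "y = -1")
    case True
    then show ?thesis by (simp add: X0_minus_1)
  next
    case False
    then have y: "y + 1 \<noteq> 0" by (simp add: add_eq_0_iff2)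
    then have "norm (kat z y * (X0 z y)\<^sup>2) < norm (kct z y)"
      using small_root_root(2)[OF assms] z by (simp add: X0_def kct_def)
    also have "kat z y * (X0 z y)\<^sup>2 = kct z y * ((X0 z y)\<^sup>2 * y)"
      by (simp add: kat_def kct_def)
    finally show ?thesis
      unfolding norm_mult[of "kct z y"] using y z by (simp add: kct_def)
  qed
qed

lemma X0_unique:
  assumes "kat z y * x\<^sup>2 + kbt z y * x + kct z y = 0" "norm (x\<^sup>2 * y) < 1"
  shows "split_quadratic (kat z y) (kbt z y) (kct z y)" and "X0 z y = x"
proof -
  have "split_quadratic (kat z y) (kbt z y) (kct z y) \<and> X0 z y = x"
  proof (cases "y = -1")
    case True
    then have "x = 0" using assms(1) by (simp add: kat_def kbt_def kct_def)
    then show ?thesis using True X0_minus_1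
      by (simp add: split_quadratic_def kat_def kbt_def kct_def)
  next
    case False
    then have "kct z y \<noteq> 0" using z by (simp add: kct_def add_eq_0_iff2)
    moreover have "kat z y * x\<^sup>2 = kct z y * (x\<^sup>2 * y)" by (simp add: kat_def kct_def)
    ultimately have "norm (kat z y * x\<^sup>2) < norm (kct z y)"
      using assms(2) by (simp only: norm_mult[of "kct z y"]) simp
    from small_root_unique[OF assms(1) this] show ?thesis by (simp add: X0_def)
  qed
  then show "split_quadratic (kat z y) (kbt z y) (kct z y)" and "X0 z y = x" by auto
qed

lemma holomorphic_Y0: "Y0 z holomorphic_on - (xcut12 z \<union> xcut34 z)"
proof -
  have "(\<lambda>x. small_root (ka z x) (kb z x) (kc z x)) holomorphic_on - (xcut12 z \<union> xcut34 z)"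
    using split_quadratic_x unfolding ka_def kb_def kc_def
    by (intro holomorphic_small_root holomorphic_intros) auto
  then show ?thesis by (simp add: Y0_def[abs_def])
qed

lemma holomorphic_X0: "X0 z holomorphic_on - (ycut12 z \<union> ycut34 z)"
proof -
  have "(\<lambda>y. small_root (kat z y) (kbt z y) (kct z y)) holomorphic_on - (ycut12 z \<union> ycut34 z)"
    using split_quadratic_y unfolding kat_def kbt_def kct_def
    by (intro holomorphic_small_root holomorphic_intros) auto
  then show ?thesis by (simp add: X0_def[abs_def])
qed

section \<open>Continuation\<close>

lemma series_on_kernel:
  assumes "ka z x * y\<^sup>2 + kb z x * y + kc z x = 0" "norm x \<le> 1" "norm y \<le> 1"
  shows "x_series z x + y_series z y - z * gessel_Q 0 0 z - x * y = 0"
  using gessel_functional_equation[OF assms(2,3) z] assms(1)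
  unfolding kernel_swap by (simp add: x_series_def y_series_def)

text \<open>The two pieces of the definition agree where both |x| < 1 and |Y0| < 1, since the
  functional equation then holds on the kernel. This glues them.\<close>

lemma x_continuation_eq:
  assumes "split_quadratic (ka z x) (kb z x) (kc z x)" "norm (Y0 z x) < 1"
  shows "x_continuation z x = z * gessel_Q 0 0 z + x * Y0 z x - y_series z (Y0 z x)"
  using series_on_kernel[OF Y0_root(1)[OF assms(1)]] assms(2)
  by (auto simp: x_continuation_def algebra_simps)

lemma y_continuation_eq:
  assumes "split_quadratic (kat z y) (kbt z y) (kct z y)" "norm (X0 z y) < 1"
  shows "y_continuation z y = z * gessel_Q 0 0 z + X0 z y * y - x_series z (X0 z y)"
  using series_on_kernel[OF X0_root(1)[OF assms(1), unfolded kernel_swap]] assms(2)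
  by (auto simp: y_continuation_def algebra_simps)

lemma holomorphic_x_series: "x_series z holomorphic_on ball 0 1"
  unfolding x_series_def[abs_def] using z
  by (intro holomorphic_intros holomorphic_gessel_Q) auto

lemma holomorphic_y_series: "y_series z holomorphic_on ball 0 1"
  unfolding y_series_def[abs_def] using z
  by (intro holomorphic_intros holomorphic_gessel_Q) auto

lemma holomorphic_x_continuation: "x_continuation z holomorphic_on - xcut34 z"
proof -
  let ?U = "- (xcut12 z \<union> xcut34 z)"
  \<comment> \<open>S is open and overlaps the disc, which takes care of the circle |x| = 1 where
    the definition by cases switches.\<close>
  define S where "S = {x \<in> ?U. norm (Y0 z x) < 1}"
  have "open ?U" by (simp only: xcut12_def xcut34_def) (intro open_Compl closed_Un closed_segment)
  then have "open (?U \<inter> Y0 z -` ball 0 1)"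
    using holomorphic_Y0 by (intro continuous_open_preimage holomorphic_on_imp_continuous_on) auto
  also have "?U \<inter> Y0 z -` ball 0 1 = S" by (auto simp: S_def)
  finally have "open S" .
  have Y: "Y0 z holomorphic_on S" using holomorphic_Y0 by (rule holomorphic_on_subset) (auto simp: S_def)
  have "(\<lambda>x. y_series z (Y0 z x)) holomorphic_on S"
    by (rule holomorphic_on_compose_gen[OF Y holomorphic_y_series, unfolded o_def]) (auto simp: S_def)
  then have "(\<lambda>x. z * gessel_Q 0 0 z + x * Y0 z x - y_series z (Y0 z x)) holomorphic_on S"
    by (intro holomorphic_intros Y)
  then have "x_continuation z holomorphic_on S"
    by (rule holomorphic_transform) (simp add: S_def x_continuation_eq split_quadratic_x)
  moreover have "x_continuation z holomorphic_on ball 0 1"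
    using holomorphic_x_series by (rule holomorphic_transform) (simp add: x_continuation_def)
  ultimately have "x_continuation z holomorphic_on (ball 0 1 \<union> S)"
    using \<open>open S\<close> by (intro holomorphic_on_Un) auto
  \<comment> \<open>The cut [x1,x2] lies in the disc, and for |x| \<ge> 1 off the other cut |Y0|
    \<le> |x Y0| < 1.\<close>
  moreover have "- xcut34 z \<subseteq> ball 0 1 \<union> S"
  proof (clarsimp simp: S_def)
    fix x assume x: "x \<notin> xcut34 z" "\<not> norm x < 1"
    then have c: "x \<notin> xcut12 z" using norm_less_1_xcut12 by auto
    then have "norm x * norm (Y0 z x) < 1"
      using Y0_root(2) split_quadratic_x x(1) by (simp add: norm_mult)
    moreover have "1 * norm (Y0 z x) \<le> norm x * norm (Y0 z x)"
      using x(2) by (intro mult_right_mono) auto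
    ultimately show "x \<notin> xcut12 z \<and> norm (Y0 z x) < 1" using c by simp
  qed
  ultimately show ?thesis by (rule holomorphic_on_subset)
qed

lemma holomorphic_y_continuation: "y_continuation z holomorphic_on - ycut34 z"
proof -
  let ?U = "- (ycut12 z \<union> ycut34 z)"
  define S where "S = {y \<in> ?U. norm (X0 z y) < 1}"
  have "open ?U" by (simp only: ycut12_def) (intro open_Compl closed_Un closed_segment closed_ycut34)
  then have "open (?U \<inter> X0 z -` ball 0 1)"
    using holomorphic_X0 by (intro continuous_open_preimage holomorphic_on_imp_continuous_on) auto
  also have "?U \<inter> X0 z -` ball 0 1 = S" by (auto simp: S_def)
  finally have "open S" .
  have X: "X0 z holomorphic_on S" using holomorphic_X0 by (rule holomorphic_on_subset) (auto simp: S_def)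
  have "(\<lambda>y. x_series z (X0 z y)) holomorphic_on S"
    by (rule holomorphic_on_compose_gen[OF X holomorphic_x_series, unfolded o_def]) (auto simp: S_def)
  then have "(\<lambda>y. z * gessel_Q 0 0 z + X0 z y * y - x_series z (X0 z y)) holomorphic_on S"
    by (intro holomorphic_intros X)
  then have "y_continuation z holomorphic_on S"
    by (rule holomorphic_transform) (simp add: S_def y_continuation_eq split_quadratic_y)
  moreover have "y_continuation z holomorphic_on ball 0 1"
    using holomorphic_y_series by (rule holomorphic_transform) (simp add: y_continuation_def)
  ultimately have "y_continuation z holomorphic_on (ball 0 1 \<union> S)"
    using \<open>open S\<close> by (intro holomorphic_on_Un) auto
  \<comment> \<open>For |y| \<ge> 1 off the cut, |X0|^2 \<le> |X0^2 y| < 1.\<close>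
  moreover have "- ycut34 z \<subseteq> ball 0 1 \<union> S"
  proof (clarsimp simp: S_def)
    fix y assume y: "y \<notin> ycut34 z" "\<not> norm y < 1"
    then have c: "y \<notin> ycut12 z" using norm_less_1_ycut12 by auto
    then have "(norm (X0 z y))\<^sup>2 * norm y < 1"
      using X0_root(2) split_quadratic_y y(1) by (simp add: norm_mult norm_power)
    moreover have "(norm (X0 z y))\<^sup>2 * 1 \<le> (norm (X0 z y))\<^sup>2 * norm y"
      using y(2) by (intro mult_left_mono) auto
    ultimately have "(norm (X0 z y))\<^sup>2 < 1" by simp
    then show "y \<notin> ycut12 z \<and> norm (X0 z y) < 1" using c by (simp add: abs_square_less_1)
  qed
  ultimately show ?thesis by (rule holomorphic_on_subset)
qed

lemma continuation_X0:
  assumes "y \<notin> ycut12 z \<union> ycut34 z"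
  shows "x_continuation z (X0 z y) + y_continuation z y - z * gessel_Q 0 0 z - X0 z y * y = 0"
proof -
  note sp = split_quadratic_y[OF assms]
  show ?thesis
  proof (cases "norm (X0 z y) < 1")
    case True
    then show ?thesis by (simp add: y_continuation_eq[OF sp True] x_continuation_def)
  next
    case False
    have lt: "norm (X0 z y) * (norm (X0 z y) * norm y) < 1"
      using X0_root(2)[OF sp] by (simp add: norm_mult norm_power power2_eq_square mult.assoc)
    have "1 * (norm (X0 z y) * norm y) \<le> norm (X0 z y) * (norm (X0 z y) * norm y)"
      "1 * norm y \<le> norm (X0 z y) * norm y"
      using False by (intro mult_right_mono; simp)+
    then have n: "norm (X0 z y * y) < 1" "norm y < 1" using lt by (auto simp: norm_mult)
    \<comment> \<open>Since |X0| \<ge> 1, the bound |X0^2 y| < 1 implies |X0 y| < 1 and |y| < 1. So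
      y is the small root over \<open>X0 z y\<close>, and the claim is the definition of
      \<open>x_continuation\<close> at that point.\<close>
    have "Y0 z (X0 z y) = y"
      using X0_root(1)[OF sp] n(1) unfolding kernel_swap by (rule Y0_unique)
    then show ?thesis using False n(2) by (simp add: x_continuation_def y_continuation_def)
  qed
qed

lemma continuation_Y0:
  assumes "x \<notin> xcut12 z \<union> xcut34 z"
  shows "x_continuation z x + y_continuation z (Y0 z x) - z * gessel_Q 0 0 z - x * Y0 z x = 0"
proof -
  note sp = split_quadratic_x[OF assms]
  show ?thesis
  proof (cases "norm (Y0 z x) < 1")
    case True
    then show ?thesis by (simp add: x_continuation_eq[OF sp True] y_continuation_def)
  next
    case False
    have lt: "norm x * norm (Y0 z x) < 1"
      using Y0_root(2)[OF sp] by (simp add: norm_mult)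
    have "norm x * 1 \<le> norm x * norm (Y0 z x)"
      using False by (intro mult_left_mono; simp)
    then have n: "norm x < 1" using lt by simp
    \<comment> \<open>Here |Y0| \<ge> 1 and |x Y0| < 1 have given |x| < 1, hence |x^2 Y0| < 1, the
      criterion making x the small root over \<open>Y0 z x\<close>.\<close>
    have "norm x * (norm x * norm (Y0 z x)) < 1"
      using n lt mult_strict_mono'[of "norm x" 1 "norm x * norm (Y0 z x)" 1] by simp
    then have "norm (x\<^sup>2 * Y0 z x) < 1"
      by (simp add: norm_mult norm_power power2_eq_square mult.assoc)
    then have "X0 z (Y0 z x) = x"
      using Y0_root(1)[OF sp] unfolding kernel_swap[symmetric] by (intro X0_unique)
    then show ?thesis using False n by (simp add: x_continuation_def y_continuation_def)
  qed
qed

end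

theorem theorem3:
  fixes z :: real
  assumes "0 < z" and "z < 1/4"
  shows "\<exists>F G :: complex \<Rightarrow> complex.
    F holomorphic_on (- xcut34 z) \<and>
    (\<forall>x\<in>ball 0 1. F x = of_real z * gessel_Q x 0 (of_real z)) \<and>
    G holomorphic_on (- ycut34 z) \<and>
    (\<forall>y\<in>ball 0 1. G y = of_real z * (y + 1) * gessel_Q 0 y (of_real z)) \<and>
    (\<forall>y \<in> - (ycut12 z \<union> ycut34 z).
       F (X0 z y) + G y - of_real z * gessel_Q 0 0 (of_real z) - X0 z y * y = 0) \<and>
    (\<forall>x \<in> - (xcut12 z \<union> xcut34 z).
       F x + G (Y0 z x) - of_real z * gessel_Q 0 0 (of_real z) - x * Y0 z x = 0)"
proof (intro exI conjI ballI)
  fix t :: complex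
  assume "t \<in> ball 0 1"
  then show "x_continuation z t = of_real z * gessel_Q t 0 (of_real z)"
    and "y_continuation z t = of_real z * (t + 1) * gessel_Q 0 t (of_real z)"
    by (simp_all add: x_continuation_def y_continuation_def x_series_def y_series_def)
qed (use holomorphic_x_continuation[OF assms] holomorphic_y_continuation[OF assms]
    continuation_X0[OF assms] continuation_Y0[OF assms] in auto)

end
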